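(* Let $k\ge 0$, $a\ge 1$ and $b\ge 0$ be integers. Then the arithmetic function $g_{k,a,b}$ is periodic. Moreover, if $\gcd(a,b)=1$, then the smallest period of $g_{k,a,b}$ equals $Q_{k,a}$, where $$Q_{k,a}:=\frac{L_k}{\delta_{k,a}\cdot\prod_{q \text{ prime},\ q\mid \gcd(a,L_k)} q^{e_{q,k}}},$$ and $$\delta_{k,a}:=\begin{cases} p^{e_{p,k}}, & \text{if } p\nmid a \text{ and } v_p(k+1)\ge e_{p,k} \text{ for some prime } p\le k,\\ 1, & \text{otherwise.}\end{cases}$$ If $\gcd(a,b)>1$, then the smallest period of $g_{k,a,b}$ is equal to $Q_{k,a'}$ with $a'=\frac{a}{\gcd(a,b)}$ (where $Q_{k,a'}$ is given by the same formula with $a$ replaced by $a'$).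
   Context: For integers $k\ge 0$, $a\ge 1$, $b\ge 0$, the function $g_{k,a,b}$ from the positive integers to the positive integers is $$g_{k,a,b}(n)=\frac{(b+na)(b+(n+1)a)\cdots(b+(n+k)a)}{\operatorname{lcm}(b+na,\,b+(n+1)a,\,\ldots,\,b+(n+k)a)}.$$ A period of a function $f$ on the positive integers is a positive integer $T$ with $f(n+T)=f(n)$ for all positive integers $n$; $f$ is periodic if it has a period, and its smallest period is the least such $T$. Set $L_0:=1$ and $L_k:=\operatorname{lcm}(1,2,\ldots,k)$ for $k\ge 1$. For a prime $p$, $v_p$ is the normalized $p$-adic valuation, and for $k\ge 1$, $e_{p,k}:=\lfloor\log_p k\rfloor=\max_{1\le i\le k}v_p(i)$. It is known that for given $k$ there is at most one prime $p\le k$ with $v_p(k+1)\ge e_{p,k}$, so $\delta_{k,a}$ is well defined. For $k\le 1$ there are no primes $p\le k$, so $\delta_{k,a}=1$ and the product in the denominator is empty. By convention $\gcd(a,0)=a$. *)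

theory Defs
  imports Complex_Main "HOL-Computational_Algebra.Primes"
begin

text \<open>Functions on the positive integers are modelled as functions on \<^typ>\<open>nat\<close> whose value
  at 0 is irrelevant: only arguments \<open>n > 0\<close> are tested.\<close>

definition is_period :: "(nat \<Rightarrow> 'a) \<Rightarrow> nat \<Rightarrow> bool" where
  "is_period f T \<longleftrightarrow> T > 0 \<and> (\<forall>n>0. f (n + T) = f n)"

definition periodic :: "(nat \<Rightarrow> 'a) \<Rightarrow> bool" where
  "periodic f \<longleftrightarrow> (\<exists>T. is_period f T)"

definition smallest_period :: "(nat \<Rightarrow> 'a) \<Rightarrow> nat" where
  "smallest_period f = (LEAST T. is_period f T)"

text \<open>The division is exact, see \<open>g_exact\<close> below.\<close>

definition g_fun :: "nat \<Rightarrow> nat \<Rightarrow> nat \<Rightarrow> nat \<Rightarrow> nat" where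
  "g_fun k a b n = (\<Prod>i=0..k. b + (n + i) * a) div Lcm ((\<lambda>i. b + (n + i) * a) ` {0..k})"

text \<open>For \<open>k = 0\<close> this is the Lcm of the empty set, which is 1.\<close>

definition L_lcm :: "nat \<Rightarrow> nat" where
  "L_lcm k = Lcm {1..k}"

text \<open>Only meaningful for \<open>k \<ge> 1\<close>, where the logarithm is nonnegative; no prime is used below
  for \<open>k = 0\<close>.\<close>

definition e_val :: "nat \<Rightarrow> nat \<Rightarrow> nat" where
  "e_val p k = nat \<lfloor>log (real p) (real k)\<rfloor>"

definition is_delta_prime :: "nat \<Rightarrow> nat \<Rightarrow> nat \<Rightarrow> bool" where
  "is_delta_prime k a p \<longleftrightarrow>
     prime p \<and> p \<le> k \<and> \<not> p dvd a \<and> multiplicity p (k + 1) \<ge> e_val p k"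

text \<open>The definite description is well defined by \<open>delta_prime_unique\<close> below.\<close>

definition delta :: "nat \<Rightarrow> nat \<Rightarrow> nat" where
  "delta k a =
     (if \<exists>p. is_delta_prime k a p
      then (let p = (THE p. is_delta_prime k a p) in p ^ e_val p k)
      else 1)"

text \<open>The division is exact, see \<open>Q_exact\<close> below.\<close>

definition Q_per :: "nat \<Rightarrow> nat \<Rightarrow> nat" where
  "Q_per k a = L_lcm k div (delta k a * (\<Prod>q\<in>{q. prime q \<and> q dvd gcd a (L_lcm k)}. q ^ e_val q k))"

lemma g_exact: "Lcm ((\<lambda>i. b + (n + i) * a) ` {0..k}) dvd (\<Prod>i=0..k. b + (n + i) * (a::nat))"
  by (rule Lcm_least) (auto intro!: dvd_prodI)

lemma e_bounds:
  assumes "prime p" "k \<ge> 1"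
  shows "p ^ e_val p k \<le> k" "k < p ^ (e_val p k + 1)"
proof -
  have p: "real p > 1" using prime_gt_1_nat[OF assms(1)] by simp
  have nn: "\<lfloor>log (real p) (real k)\<rfloor> \<ge> 0" using p assms(2) by simp
  then have "real (e_val p k) \<le> log (real p) (real k)" "log (real p) (real k) < real (e_val p k + 1)"
    unfolding e_val_def by (simp_all, linarith+)
  then have "real p powr real (e_val p k) \<le> real k" "real k < real p powr real (e_val p k + 1)"
    using p assms(2) by (simp_all add: le_log_iff log_less_iff)
  then have "real (p ^ e_val p k) \<le> real k" "real k < real (p ^ (e_val p k + 1))"
    using p by (simp_all only: powr_realpow of_nat_power)
  then show "p ^ e_val p k \<le> k" "k < p ^ (e_val p k + 1)" by (simp_all only: of_nat_le_iff of_nat_less_iff)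
qed

lemma e_eq_Max_multiplicity:
  assumes "prime p" "k \<ge> 1"
  shows "e_val p k = Max (multiplicity p ` {1..k})"
proof (rule Max_eqI[symmetric])
  fix v assume "v \<in> multiplicity p ` {1..k}"
  then obtain i where i: "i \<in> {1..k}" "v = multiplicity p i" by auto
  have "p ^ v \<le> i" using i by (intro dvd_imp_le) (auto simp: multiplicity_dvd)
  also have "\<dots> < p ^ (e_val p k + 1)" using i e_bounds(2)[OF assms] by auto
  finally show "v \<le> e_val p k"
    using prime_gt_1_nat[OF assms(1)] by (simp only: power_strict_increasing_iff)
next
  have "multiplicity p (p ^ e_val p k) = e_val p k" using assms by simp
  moreover have "p ^ e_val p k \<in> {1..k}"
    using e_bounds(1)[OF assms] prime_gt_0_nat[OF assms(1)] by (simp add: Suc_le_eq)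
  ultimately show "e_val p k \<in> multiplicity p ` {1..k}" by (metis imageI)
qed simp

lemma delta_prime_unique:
  assumes "is_delta_prime k a p" "is_delta_prime k a q"
  shows "p = q"
proof -
  have False if pq: "p < q" and "is_delta_prime k a p" "is_delta_prime k a q" for p q
  proof -
    have p: "prime p" "p \<le> k" "p ^ e_val p k dvd k + 1"
      and q: "prime q" "q \<le> k" "q ^ e_val q k dvd k + 1"
      using that by (auto simp: is_delta_prime_def intro: multiplicity_dvd')
    have k: "k \<ge> 1" using p(2) prime_gt_0_nat[OF p(1)] by simp
    have "coprime (p ^ e_val p k) (q ^ e_val q k)"
      using primes_coprime[OF p(1) q(1)] pq by simp
    then have "p ^ e_val p k * q ^ e_val q k dvd k + 1" using p(3) q(3) by (rule divides_mult[rotated 2])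
    then have le: "p ^ e_val p k * q ^ e_val q k \<le> k + 1" by (rule dvd_imp_le) simp
    have "e_val q k \<noteq> 0" using e_bounds(2)[OF q(1) k] q(2) by (intro notI) simp
    then have "q \<le> q ^ e_val q k" using prime_gt_0_nat[OF q(1)] by (simp add: self_le_power)
    then have "p < q ^ e_val q k" using pq by simp
    then have "p ^ e_val p k * p < p ^ e_val p k * q ^ e_val q k"
      using prime_gt_0_nat[OF p(1)] by (intro mult_strict_left_mono) auto
    moreover have "k + 1 \<le> p ^ e_val p k * p" using e_bounds(2)[OF p(1) k] by (simp add: mult.commute)
    ultimately show False using le by linarith
  qed
  then show ?thesis using assms by (meson linorder_neqE_nat)
qed

lemma prime_power_e_dvd_L:
  assumes "prime p" "k \<ge> 1"
  shows "p ^ e_val p k dvd L_lcm k"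
  unfolding L_lcm_def
  using e_bounds(1)[OF assms] prime_gt_0_nat[OF assms(1)] by (intro dvd_Lcm) (simp add: Suc_le_eq)

lemma Q_exact: "delta k a * (\<Prod>q\<in>{q. prime q \<and> q dvd gcd a (L_lcm k)}. q ^ e_val q k) dvd L_lcm k"
proof (cases "k = 0")
  case True
  have no: "{q::nat. prime q \<and> q dvd gcd a (L_lcm k)} = {}"
    using True by (auto simp: L_lcm_def)
  have "delta k a = 1" using True by (auto simp: delta_def is_delta_prime_def)
  then show ?thesis unfolding no by simp
next
  case False
  then have k: "k \<ge> 1" by simp
  let ?A = "{q. prime q \<and> q dvd gcd a (L_lcm k)}"
  have prod_dvd: "(\<Prod>q\<in>B. q ^ e_val q k) dvd L_lcm k" if "finite B" "\<And>q. q \<in> B \<Longrightarrow> prime q" for B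
    using that
  proof (induction B rule: finite_induct)
    case (insert x B)
    have "coprime (x ^ e_val x k) (\<Prod>q\<in>B. q ^ e_val q k)"
      using insert by (intro prod_coprime_right) (auto intro!: primes_coprime)
    then show ?case
      using insert prime_power_e_dvd_L[OF _ k] by (simp add: divides_mult)
  qed simp
  have "L_lcm k \<noteq> 0" unfolding L_lcm_def by (simp add: Lcm_0_iff)
  then have fin: "finite ?A"
    by (intro finite_subset[OF _ finite_divisors_nat[of "L_lcm k"]]) auto
  show ?thesis
  proof (cases "\<exists>p. is_delta_prime k a p")
    case True
    then obtain p where p: "is_delta_prime k a p" by blast
    then have "(THE p. is_delta_prime k a p) = p" by (blast intro: delta_prime_unique)
    then have d: "delta k a = p ^ e_val p k" using p by (auto simp: delta_def Let_def)
    have "p \<notin> ?A" using p by (auto simp: is_delta_prime_def)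
    then have "delta k a * (\<Prod>q\<in>?A. q ^ e_val q k) = (\<Prod>q\<in>insert p ?A. q ^ e_val q k)"
      using fin d by simp
    also have "\<dots> dvd L_lcm k" using fin p by (intro prod_dvd) (auto simp: is_delta_prime_def)
    finally show ?thesis .
  next
    case False
    then have "delta k a = 1" by (simp add: delta_def)
    then show ?thesis using prod_dvd[OF fin] by simp
  qed
qed

end

theory Submission
  imports Defs "HOL-Number_Theory.Cong"
begin

text \<open>
  Write \<open>x\<^sub>i = b + (n + i) a\<close> and let \<open>N(m, n)\<close> be the number of \<open>i \<le> k\<close> with \<open>m dvd x\<^sub>i\<close>. Fix a
  prime \<open>p\<close>. Each power \<open>p\<^sup>j\<close> contributes \<open>N(p\<^sup>j, n)\<close> to the valuation of the product of the \<open>x\<^sub>i\<close>,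
  and \<open>1\<close> or \<open>0\<close> to that of their lcm, according as some \<open>x\<^sub>i\<close> is divisible by \<open>p\<^sup>j\<close> or none is.
  So the valuation of \<open>g(n)\<close> is the sum over \<open>j\<close> of the truncated differences \<open>N(p\<^sup>j, n) - 1\<close>. Assume
  that \<open>a\<close> and \<open>b\<close> are coprime. If \<open>p dvd a\<close>, no \<open>x\<^sub>i\<close> is divisible by \<open>p\<close>; otherwise a power
  \<open>p\<^sup>j > k\<close> divides at most one of the \<open>x\<^sub>i\<close>. Either way only the \<open>j\<close> up to
  \<open>e = e_val p k\<close> count (\<open>multiplicity_g_fun\<close>).

  Let \<open>p\<close> not divide \<open>a\<close>. Then \<open>N(p\<^sup>j, -)\<close> has period \<open>p\<^sup>j\<close>, so the valuation of \<open>g\<close> has period \<open>p\<^sup>e\<close>;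
  and if \<open>p\<^sup>e dvd k + 1\<close>, the window is a union of full residue systems modulo each \<open>p\<^sup>j\<close> and the
  valuation is constant. If \<open>p\<^sup>e\<close> does not divide \<open>k + 1\<close>, every period \<open>T\<close> of \<open>g\<close> is a multiple of
  \<open>p\<^sup>e\<close>: otherwise some multiple \<open>T'\<close> of \<open>T\<close> has valuation exactly \<open>e - 1\<close>; it is a period of
  \<open>N(p\<^sup>j, -)\<close> for all \<open>j < e\<close>, hence also of \<open>N(p\<^sup>e, -)\<close>, as these
  counts are at least \<open>1\<close> and no difference is truncated. But that function drops from \<open>n\<close> to
  \<open>n + 1\<close> precisely at those \<open>n\<close> for which \<open>p\<^sup>e dvd b + n a\<close>, so its periods are multiples of \<open>p\<^sup>e\<close>
  (\<open>dvd_period_of_window_hits\<close>).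

  Consequently the periods are the positive multiples of the product of the \<open>p\<^sup>e\<close> over the primes
  \<open>p \<le> k\<close> with \<open>p\<close> not dividing \<open>a\<close> and \<open>p\<^sup>e\<close> not dividing \<open>k + 1\<close>. This product is \<open>Q_per k a\<close>,
  because \<open>L_lcm k\<close> is the product of all \<open>p\<^sup>e\<close> with \<open>p \<le> k\<close>, and the denominator of \<open>Q_per\<close> removes
  the other primes. Dividing \<open>a\<close> and \<open>b\<close> by their gcd \<open>d\<close> divides \<open>g\<close> by the constant
  \<open>d\<^sup>k\<close>, which reduces everything to the coprime case.
\<close>

section \<open>Multiples in a window of an arithmetic progression\<close>

definition window_hits :: "nat \<Rightarrow> nat \<Rightarrow> nat \<Rightarrow> nat \<Rightarrow> nat \<Rightarrow> nat" where
  "window_hits k a b m n = (\<Sum>i=0..k. of_bool (m dvd b + (n + i) * a))"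

lemma window_hits_add_period:
  assumes "m dvd T"
  shows "window_hits k a b m (n + T) = window_hits k a b m n"
proof -
  have "m dvd b + (n + T + i) * a \<longleftrightarrow> m dvd b + (n + i) * a" for i
  proof -
    have "b + (n + T + i) * a = (b + (n + i) * a) + T * a" by (simp add: algebra_simps)
    then show ?thesis using assms by (simp only: dvd_add_left_iff dvd_mult2)
  qed
  then show ?thesis by (simp add: window_hits_def)
qed

text \<open>Both sides count the hits in the window of length \<open>k + 2\<close> starting at \<open>n\<close>; subtraction is
  avoided so that the identity can be stated in the natural numbers.\<close>

lemma window_hits_step:
  "window_hits k a b m (n + 1) + of_bool (m dvd b + n * a)
    = window_hits k a b m n + of_bool (m dvd b + (n + (k + 1)) * a)"
proof -
  let ?f = "\<lambda>i. of_bool (m dvd b + (n + i) * a) :: nat"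
  have "sum ?f {0..Suc k} = window_hits k a b m n + ?f (Suc k)"
    unfolding window_hits_def by (rule sum.atLeast0_atMost_Suc)
  moreover have "sum ?f {0..Suc k} = ?f 0 + window_hits k a b m (n + 1)"
    unfolding window_hits_def sum.atLeast0_atMost_Suc_shift by (simp add: comp_def)
  ultimately show ?thesis by simp
qed

lemma dvd_progression_shift_iff:
  fixes m a b n t :: nat
  assumes "coprime m a" "m dvd b + n * a"
  shows "m dvd b + (n + t) * a \<longleftrightarrow> m dvd t"
proof -
  have "b + (n + t) * a = (b + n * a) + t * a" by (simp add: algebra_simps)
  then show ?thesis using assms by (simp only: dvd_add_right_iff coprime_dvd_mult_left_iff)
qed

text \<open>As \<open>a\<close> is invertible modulo \<open>m\<close>, the progression runs through all residues modulo \<open>m\<close>.\<close>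

lemma progression_hit_exists:
  fixes m a b n :: nat
  assumes "coprime m a" "m > 0"
  shows "\<exists>i<m. m dvd b + (n + i) * a"
proof -
  obtain x where x: "[a * x = 1] (mod m)"
    using cong_solve_coprime_nat[of a m] assms(1) by (auto simp: coprime_commute)
  \<comment> \<open>\<open>c\<close> is a natural number congruent to \<open>- (b + n * a)\<close>, and \<open>x\<close> is an inverse of \<open>a\<close>.\<close>
  define c where "c = (m - 1) * (b + n * a)"
  define i where "i = (c * x) mod m"
  have "[i * a = c * (a * x)] (mod m)"
    unfolding i_def by (simp add: cong_def mod_mult_left_eq mult.assoc [symmetric] mult.commute [of _ a] mod_mult_right_eq)
  also have "[c * (a * x) = c * 1] (mod m)" by (intro cong_mult cong_refl x)
  finally have "[(b + n * a) + i * a = (b + n * a) + c] (mod m)" by (simp add: cong_add_lcancel_nat)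
  moreover have "(b + n * a) + c = m * (b + n * a)"
    using assms(2) by (cases m) (simp_all add: c_def)
  ultimately have "m dvd (b + n * a) + i * a"
    by (metis cong_dvd_iff dvd_triv_left)
  then have "m dvd b + (n + i) * a" by (simp add: algebra_simps)
  moreover have "i < m" using assms(2) by (simp add: i_def)
  ultimately show ?thesis by blast
qed

lemma window_hits_pos:
  assumes "coprime m a" "m > 0" "m \<le> k + 1"
  shows "window_hits k a b m n \<ge> 1"
proof -
  obtain i where i: "i < m" "m dvd b + (n + i) * a"
    using progression_hit_exists[OF assms(1,2)] by blast
  have "of_bool (m dvd b + (n + i) * a) \<le> window_hits k a b m n"
    unfolding window_hits_def using i assms(3) by (intro member_le_sum) auto
  then show ?thesis using i by simp
qed

text \<open>Two hits at positions \<open>i \<le> j\<close> have \<open>m dvd j - i\<close>, while \<open>j - i \<le> k < m\<close>.\<close>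

lemma window_hits_le_1:
  assumes "coprime m a" "k < m"
  shows "window_hits k a b m n \<le> 1"
proof -
  let ?S = "{0..k} \<inter> {i. m dvd b + (n + i) * a}"
  have "i = j" if "i \<in> ?S" "j \<in> ?S" "i \<le> j" for i j
  proof -
    have "m dvd b + (n + i) * a" "m dvd b + (n + i + (j - i)) * a" using that by simp_all
    then have "m dvd j - i" using dvd_progression_shift_iff[OF assms(1)] by blast
    moreover have "j - i < m" using that assms(2) by auto
    ultimately have "j - i = 0" using nat_dvd_not_less by blast
    then show ?thesis using that(3) by simp
  qed
  then have "\<forall>i\<in>?S. \<forall>j\<in>?S. i = j" by (metis nat_le_linear)
  then have "card ?S \<le> 1" by (metis card_le_Suc0_iff_eq finite_Int finite_atLeastAtMost One_nat_def)
  then show ?thesis by (simp add: window_hits_def sum.If_cases of_bool_def)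
qed

text \<open>Moving the window one step exchanges \<open>b + n * a\<close> for a number congruent to it modulo \<open>m\<close>.\<close>

lemma window_hits_const:
  assumes "m dvd k + 1"
  shows "window_hits k a b m (n + T) = window_hits k a b m n"
proof (induction T)
  case (Suc T)
  have "b + (n + T + (k + 1)) * a = (b + (n + T) * a) + (k + 1) * a" by (simp add: algebra_simps)
  then have "m dvd b + (n + T + (k + 1)) * a \<longleftrightarrow> m dvd b + (n + T) * a"
    using assms by (simp only: dvd_add_left_iff dvd_mult2)
  then show ?case using window_hits_step[of k a b m "n + T"] Suc by simp
qed simp

text \<open>The count decreases from \<open>n\<close> to \<open>n + 1\<close> only if a hit leaves the window at \<open>n\<close>, and since
  \<open>m\<close> does not divide \<open>k + 1\<close> every hit that leaves causes a decrease. A period preserves the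
  places of decrease, hence maps a hit to a hit, and hits lie at distances divisible by \<open>m\<close>.\<close>

lemma dvd_period_of_window_hits:
  assumes "coprime m a" "m > 0" "\<not> m dvd k + 1"
    and per: "\<And>n. n > 0 \<Longrightarrow> window_hits k a b m (n + T) = window_hits k a b m n"
  shows "m dvd T"
proof -
  obtain i where "m dvd b + (1 + i) * a"
    using progression_hit_exists[OF assms(1,2)] by blast
  then obtain n where n: "n > 0" "m dvd b + n * a" by (metis add_gr_0 zero_less_one)
  have "\<not> m dvd b + (n + (k + 1)) * a"
    using dvd_progression_shift_iff[OF assms(1) n(2)] assms(3) by blast
  then have "window_hits k a b m (n + 1) + 1 = window_hits k a b m n"
    using window_hits_step[of k a b m n] n(2) by simp
  then have drop: "window_hits k a b m (n + T + 1) + 1 = window_hits k a b m (n + T)"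
    using per[OF n(1)] per[of "n + 1"] by (simp add: ac_simps)
  have "m dvd b + (n + T) * a"
    using window_hits_step[of k a b m "n + T"] drop by (auto split: if_splits simp: of_bool_def)
  then show ?thesis using dvd_progression_shift_iff[OF assms(1) n(2)] by blast
qed

lemma window_hits_prime_dvd:
  assumes p: "prime p" and pa: "p dvd a" and ab: "coprime a b" and j: "j \<ge> 1"
  shows "window_hits k a b (p ^ j) n = 0"
proof -
  have "\<not> p dvd b" using ab p pa coprime_common_divisor not_prime_unit by blast
  then have "\<not> p dvd b + (n + i) * a" for i
    using pa by (simp only: dvd_add_left_iff dvd_mult not_False_eq_True)
  moreover have "p dvd p ^ j" using j by (intro dvd_power) auto
  ultimately have "\<not> p ^ j dvd b + (n + i) * a" for i using dvd_trans by blast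
  then show ?thesis by (simp add: window_hits_def)
qed

section \<open>Prime powers and least common multiples\<close>

lemma prime_power_dvd_iff_le_multiplicity:
  fixes p x :: nat
  assumes "prime p" "x > 0"
  shows "p ^ j dvd x \<longleftrightarrow> j \<le> multiplicity p x"
  using assms by (intro power_dvd_iff_le_multiplicity) auto

lemma prime_power_dvd_lcm_iff:
  fixes p x y :: nat
  assumes "prime p" "x > 0" "y > 0"
  shows "p ^ j dvd lcm x y \<longleftrightarrow> p ^ j dvd x \<or> p ^ j dvd y"
proof -
  have "multiplicity p (lcm x y) = max (multiplicity p x) (multiplicity p y)"
    using assms by (intro multiplicity_lcm) auto
  then show ?thesis
    using assms by (simp add: prime_power_dvd_iff_le_multiplicity lcm_pos_nat le_max_iff_disj)
qed

text \<open>For \<open>j = 0\<close> this would fail for the empty set, whose lcm is \<open>1\<close>.\<close>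

lemma prime_power_dvd_Lcm_iff:
  fixes A :: "nat set"
  assumes "prime p" "j \<ge> 1" "finite A" "0 \<notin> A"
  shows "p ^ j dvd Lcm A \<longleftrightarrow> (\<exists>x\<in>A. p ^ j dvd x)"
  using assms(3,4)
proof (induction A rule: finite_induct)
  case empty
  have "p \<noteq> 1" "j \<noteq> 0" using assms(2) prime_gt_1_nat[OF assms(1)] by simp_all
  then show ?case by simp
next
  case (insert x A)
  then have "x > 0" "Lcm A \<noteq> 0" using Lcm_0_iff[of A] by auto
  then have "p ^ j dvd lcm x (Lcm A) \<longleftrightarrow> p ^ j dvd x \<or> p ^ j dvd Lcm A"
    using prime_power_dvd_lcm_iff[OF assms(1)] by blast
  then show ?case using insert by simp
qed

text \<open>The common bound \<open>M\<close> makes the sums for different numbers run over the same range, so that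
  sums over numbers and over exponents can be exchanged.\<close>

lemma multiplicity_eq_sum_of_bool:
  fixes p x :: nat
  assumes "prime p" "x > 0" "multiplicity p x \<le> M"
  shows "multiplicity p x = (\<Sum>j=1..M. of_bool (p ^ j dvd x))"
proof -
  have "{1..M} \<inter> {j. p ^ j dvd x} = {1..multiplicity p x}"
    using assms by (auto simp: prime_power_dvd_iff_le_multiplicity)
  then show ?thesis by (simp add: of_bool_def sum.If_cases)
qed

lemma less_power_Suc_e_val:
  assumes "prime p"
  shows "k < p ^ (e_val p k + 1)"
proof (cases "k = 0")
  case True
  then show ?thesis using prime_gt_0_nat[OF assms] by simp
next
  case False
  then show ?thesis using e_bounds(2)[OF assms] by simp
qed

lemma power_le_iff_le_e_val:
  assumes "prime p" "k \<ge> 1"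
  shows "p ^ j \<le> k \<longleftrightarrow> j \<le> e_val p k"
proof
  assume "p ^ j \<le> k"
  then have "p ^ j < p ^ (e_val p k + 1)" using less_power_Suc_e_val[OF assms(1)] by (rule le_less_trans)
  then show "j \<le> e_val p k" using prime_gt_1_nat[OF assms(1)] by (simp only: power_strict_increasing_iff)
next
  assume "j \<le> e_val p k"
  then have "p ^ j \<le> p ^ e_val p k" using prime_gt_0_nat[OF assms(1)] by (intro power_increasing) auto
  then show "p ^ j \<le> k" using e_bounds(1)[OF assms] by simp
qed

lemma e_val_eq_0:
  assumes "prime p" "k < p"
  shows "e_val p k = 0"
proof (cases "k = 0")
  case True
  then show ?thesis by (simp add: e_val_def log_def)
next
  case False
  then show ?thesis using power_le_iff_le_e_val[OF assms(1), of k 1] assms(2) by simp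
qed

section \<open>The valuation of the quotient of product and lcm\<close>

lemma Lcm_progression_pos:
  fixes k a b n :: nat
  assumes "a \<ge> 1" "n > 0"
  shows "Lcm ((\<lambda>i. b + (n + i) * a) ` {0..k}) > 0"
proof -
  have "0 \<notin> (\<lambda>i. b + (n + i) * a) ` {0..k}" using assms by auto
  then have "Lcm ((\<lambda>i. b + (n + i) * a) ` {0..k}) \<noteq> 0" by (subst Lcm_0_iff) auto
  then show ?thesis by blast
qed

lemma g_fun_mult_Lcm:
  "g_fun k a b n * Lcm ((\<lambda>i. b + (n + i) * a) ` {0..k}) = (\<Prod>i=0..k. b + (n + i) * a)"
  unfolding g_fun_def using g_exact by (rule dvd_div_mult_self)

lemma g_fun_pos:
  assumes "a \<ge> 1" "n > 0"
  shows "g_fun k a b n > 0"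
proof -
  have "(\<Prod>i=0..k. b + (n + i) * a) > 0" using assms by (intro prod_pos) auto
  then show ?thesis using g_fun_mult_Lcm[of k a b n] by (metis gr0I mult_0 less_irrefl)
qed

text \<open>The valuation of the product is the sum of the hit counts, that of the lcm is the number of
  exponents with at least one hit. Their difference is a sum of truncated differences: for an
  exponent without hits, \<open>0 - 1 = 0\<close> is the correct contribution. Exponents above \<open>e_val p k\<close>
  contribute nothing, since the window contains at most one hit for them.\<close>

lemma multiplicity_g_fun:
  assumes p: "prime p" and a_pos: "a \<ge> 1" and n: "n > 0" and ab: "coprime a b"
  shows "multiplicity p (g_fun k a b n) = (\<Sum>j=1..e_val p k. window_hits k a b (p ^ j) n - 1)"
proof -
  let ?x = "\<lambda>i. b + (n + i) * a"
  let ?H = "\<lambda>j. window_hits k a b (p ^ j) n"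
  let ?e = "e_val p k"
  have nz: "0 \<notin> ?x ` {0..k}" using n a_pos by auto
  define P where "P = (\<Prod>i=0..k. ?x i)"
  define L where "L = Lcm (?x ` {0..k})"
  \<comment> \<open>\<open>M\<close> bounds all valuations involved and also the range of summation in the claim.\<close>
  define M where "M = ?e + multiplicity p P"
  have L: "L > 0" using Lcm_progression_pos[OF a_pos n] by (simp add: L_def)
  have P: "P > 0" unfolding P_def using n a_pos by (intro prod_pos) auto
  have "P = g_fun k a b n * L" using g_fun_mult_Lcm by (simp add: P_def L_def)
  then have split: "multiplicity p P = multiplicity p (g_fun k a b n) + multiplicity p L"
    using p L g_fun_pos[OF a_pos n] by (simp add: prime_elem_multiplicity_mult_distrib)
  have "multiplicity p P = (\<Sum>i=0..k. multiplicity p (?x i))"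
    unfolding P_def using p nz
    by (intro prime_elem_multiplicity_prod_distrib) auto
  also have "\<dots> = (\<Sum>i=0..k. \<Sum>j=1..M. of_bool (p ^ j dvd ?x i))"
  proof (intro sum.cong refl multiplicity_eq_sum_of_bool p)
    fix i assume "i \<in> {0..k}"
    show "?x i > 0" using n a_pos by simp
  next
    fix i assume "i \<in> {0..k}"
    then have "?x i dvd P" unfolding P_def by (intro dvd_prodI) auto
    then have "multiplicity p (?x i) \<le> multiplicity p P" using P by (intro dvd_imp_multiplicity_le) auto
    then show "multiplicity p (?x i) \<le> M" by (simp add: M_def)
  qed
  also have "\<dots> = (\<Sum>j=1..M. ?H j)" unfolding window_hits_def by (rule sum.swap)
  finally have mP: "multiplicity p P = (\<Sum>j=1..M. ?H j)" .
  have "multiplicity p L = (\<Sum>j=1..M. of_bool (p ^ j dvd L))"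
    using split by (intro multiplicity_eq_sum_of_bool p L) (simp add: M_def)
  also have "\<dots> = (\<Sum>j=1..M. of_bool (?H j \<ge> 1))"
  proof (intro sum.cong refl)
    fix j assume j: "j \<in> {1..M}"
    have "p ^ j dvd L \<longleftrightarrow> (\<exists>i\<in>{0..k}. p ^ j dvd ?x i)"
      unfolding L_def using prime_power_dvd_Lcm_iff[OF p, of j "?x ` {0..k}"] j nz by simp
    also have "\<dots> \<longleftrightarrow> ?H j \<noteq> 0"
      unfolding window_hits_def by (subst sum_eq_0_iff) auto
    finally show "(of_bool (p ^ j dvd L) :: nat) = of_bool (?H j \<ge> 1)" by (simp add: Suc_le_eq)
  qed
  finally have mL: "multiplicity p L = (\<Sum>j=1..M. of_bool (?H j \<ge> 1))" .
  have "(\<Sum>j=1..M. ?H j) = (\<Sum>j=1..M. ?H j - 1) + (\<Sum>j=1..M. of_bool (?H j \<ge> 1))"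
    unfolding sum.distrib[symmetric] by (intro sum.cong refl) auto
  then have "multiplicity p (g_fun k a b n) = (\<Sum>j=1..M. ?H j - 1)"
    using split mP mL by simp
  also have "\<dots> = (\<Sum>j=1..?e. ?H j - 1)"
  proof (rule sum.mono_neutral_right)
    show "\<forall>j\<in>{1..M} - {1..?e}. ?H j - 1 = 0"
    proof
      fix j assume j: "j \<in> {1..M} - {1..?e}"
      show "?H j - 1 = 0"
      proof (cases "p dvd a")
        case True
        then show ?thesis using window_hits_prime_dvd[OF p _ ab] j by simp
      next
        case False
        then have "coprime (p ^ j) a" using p by (simp add: prime_imp_coprime)
        moreover have "p ^ (?e + 1) \<le> p ^ j"
          using j prime_gt_0_nat[OF p] by (intro power_increasing) auto
        then have "k < p ^ j" using less_power_Suc_e_val[OF p] by (rule less_le_trans[rotated])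
        ultimately show ?thesis using window_hits_le_1 by simp
      qed
    qed
  qed (auto simp: M_def)
  finally show ?thesis .
qed

section \<open>Characterisation of the periods\<close>

text \<open>If \<open>T\<close> were not a multiple of \<open>p ^ e_val p k\<close>, some multiple of \<open>T\<close> would have valuation exactly
  \<open>e_val p k - 1\<close>. The levels \<open>j < e_val p k\<close> have this multiple as a period and can be
  subtracted, so the count of hits at the top level would have it as a period too, contradicting
  \<open>dvd_period_of_window_hits\<close>.\<close>

lemma prime_power_dvd_period_g_fun:
  assumes a_pos: "a \<ge> 1" and ab: "coprime a b"
    and per: "is_period (g_fun k a b) T"
    and p: "prime p" "\<not> p dvd a" and k1: "\<not> p ^ e_val p k dvd k + 1"
  shows "p ^ e_val p k dvd T"
proof (rule ccontr)
  assume no: "\<not> p ^ e_val p k dvd T"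
  define e where "e = e_val p k"
  have T: "T > 0" using per by (simp add: is_period_def)
  have cop: "coprime (p ^ j) a" for j using p by (simp add: prime_imp_coprime)
  have p_pos: "p ^ j > 0" for j using p(1) prime_gt_0_nat by simp
  have "k \<ge> p"
  proof (rule ccontr)
    assume "\<not> k \<ge> p"
    then have "e_val p k = 0" using p(1) by (intro e_val_eq_0) auto
    then show False using k1 by simp
  qed
  then have k: "k \<ge> 1" using prime_gt_0_nat[OF p(1)] by linarith
  define m where "m = multiplicity p T"
  have m: "m < e"
    using no prime_power_dvd_iff_le_multiplicity[OF p(1) T, of e] by (simp add: e_def m_def)
  define T' where "T' = p ^ (e - 1 - m) * T"
  have T': "T' > 0" using T prime_gt_0_nat[OF p(1)] by (simp add: T'_def)
  have "multiplicity p T' = (e - 1 - m) + m"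
    unfolding T'_def m_def using p(1) T prime_gt_0_nat[OF p(1)]
    by (subst prime_elem_multiplicity_mult_distrib) auto
  then have mT': "multiplicity p T' = e - 1" using m by simp
  have per_mult: "g_fun k a b (n + c * T) = g_fun k a b n" if "n > 0" for n c
  proof (induction c)
    case (Suc c)
    have "g_fun k a b (n + c * T + T) = g_fun k a b (n + c * T)"
      using per that by (simp add: is_period_def)
    then show ?case using Suc by (simp add: ac_simps)
  qed simp
  let ?H = "\<lambda>j n. window_hits k a b (p ^ j) n"
  have "?H e (n + T') = ?H e n" if n: "n > 0" for n
  proof -
    have "g_fun k a b (n + T') = g_fun k a b n" unfolding T'_def by (rule per_mult[OF n])
    moreover have nT: "n + T' > 0" using n by simp
    ultimately have "(\<Sum>j=1..e. ?H j (n + T') - 1) = (\<Sum>j=1..e. ?H j n - 1)"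
      using multiplicity_g_fun[OF p(1) a_pos n ab, of k] multiplicity_g_fun[OF p(1) a_pos nT ab, of k]
      unfolding e_def by metis
    moreover have "{1..e} = insert e {1..e - 1}" "e \<notin> {1..e - 1}" using m by auto
    moreover have "(\<Sum>j=1..e-1. ?H j (n + T') - 1) = (\<Sum>j=1..e-1. ?H j n - 1)"
    proof (intro sum.cong refl)
      fix j assume "j \<in> {1..e-1}"
      then have "p ^ j dvd T'" using mT' by (intro multiplicity_dvd') auto
      then show "?H j (n + T') - 1 = ?H j n - 1" by (simp add: window_hits_add_period)
    qed
    ultimately have "?H e (n + T') - 1 = ?H e n - 1" by simp
    \<comment> \<open>Both counts are at least \<open>1\<close>, so the truncated subtraction can be cancelled.\<close>
    moreover have "p ^ e \<le> k + 1" using e_bounds(1)[OF p(1) k] by (simp add: e_def)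
    ultimately show ?thesis
      using window_hits_pos[OF cop p_pos, of e k b n] window_hits_pos[OF cop p_pos, of e k b "n + T'"]
      by linarith
  qed
  then have "p ^ e dvd T'"
    using dvd_period_of_window_hits[OF cop p_pos] k1 unfolding e_def by blast
  then show False
    using mT' m prime_power_dvd_iff_le_multiplicity[OF p(1) T', of e] by simp
qed

text \<open>It suffices to compare valuations at every prime. A prime with \<open>p dvd a\<close> never hits, one with
  \<open>p ^ e_val p k dvd k + 1\<close> hits equally often in every window, and for all others each level has
  period \<open>T\<close>.\<close>

lemma is_period_g_funI:
  assumes a_pos: "a \<ge> 1" and ab: "coprime a b" and T: "T > 0"
    and dvd: "\<And>p. prime p \<Longrightarrow> \<not> p dvd a \<Longrightarrow> \<not> p ^ e_val p k dvd k + 1 \<Longrightarrow> p ^ e_val p k dvd T"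
  shows "is_period (g_fun k a b) T"
  unfolding is_period_def
proof (intro conjI allI impI T)
  fix n :: nat assume n: "n > 0"
  then have nT: "n + T > 0" by simp
  show "g_fun k a b (n + T) = g_fun k a b n"
  proof (rule multiplicity_eq_nat)
    fix p :: nat assume p: "prime p"
    have "window_hits k a b (p ^ j) (n + T) - 1 = window_hits k a b (p ^ j) n - 1"
      if j: "j \<in> {1..e_val p k}" for j
    proof -
      have pj: "p ^ j dvd p ^ e_val p k" using j by (intro le_imp_power_dvd) auto
      consider "p dvd a" | "\<not> p dvd a" "p ^ e_val p k dvd k + 1" | "p ^ e_val p k dvd T"
        using dvd p by blast
      then show ?thesis
      proof cases
        case 1
        then have "window_hits k a b (p ^ j) n = 0" for n
          using window_hits_prime_dvd[OF p _ ab] j by simp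
        then show ?thesis by simp
      next
        case 2
        then show ?thesis using window_hits_const[OF dvd_trans[OF pj 2(2)]] by simp
      next
        case 3
        then show ?thesis using window_hits_add_period[OF dvd_trans[OF pj 3]] by simp
      qed
    qed
    then show "multiplicity p (g_fun k a b (n + T)) = multiplicity p (g_fun k a b n)"
      using multiplicity_g_fun[OF p a_pos n ab, of k] multiplicity_g_fun[OF p a_pos nT ab, of k] by simp
  qed (use n nT g_fun_pos[OF a_pos] in auto)
qed

section \<open>The formula for the least period\<close>

text \<open>The primes at which the valuation of \<open>g_fun k a b\<close> is not constant, when \<open>a\<close> and \<open>b\<close> are
  coprime.\<close>

definition essential_primes :: "nat \<Rightarrow> nat \<Rightarrow> nat set" where
  "essential_primes k a = {p. prime p \<and> p \<le> k \<and> \<not> p dvd a \<and> \<not> p ^ e_val p k dvd k + 1}"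

lemma finite_essential_primes: "finite (essential_primes k a)"
  by (rule finite_subset[of _ "{..k}"]) (auto simp: essential_primes_def)

lemma prime_power_dvd_L_lcm_iff:
  assumes "prime p" "j \<ge> 1"
  shows "p ^ j dvd L_lcm k \<longleftrightarrow> p ^ j \<le> k"
proof -
  have "p ^ j dvd L_lcm k \<longleftrightarrow> (\<exists>i\<in>{1..k}. p ^ j dvd i)"
    unfolding L_lcm_def by (rule prime_power_dvd_Lcm_iff) (use assms in auto)
  also have "\<dots> \<longleftrightarrow> p ^ j \<le> k"
  proof
    assume "\<exists>i\<in>{1..k}. p ^ j dvd i"
    then obtain i where "i \<ge> 1" "i \<le> k" "p ^ j dvd i" by auto
    then show "p ^ j \<le> k" using dvd_imp_le[of "p ^ j" i] by linarith
  next
    assume "p ^ j \<le> k"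
    then have "p ^ j \<in> {1..k}" using prime_gt_0_nat[OF assms(1)] by (simp add: Suc_le_eq)
    then show "\<exists>i\<in>{1..k}. p ^ j dvd i" by (rule bexI[rotated]) (rule dvd_refl)
  qed
  finally show ?thesis .
qed

lemma prime_dvd_L_lcm_iff:
  assumes "prime p"
  shows "p dvd L_lcm k \<longleftrightarrow> p \<le> k"
  using prime_power_dvd_L_lcm_iff[OF assms, of 1 k] by simp

lemma L_lcm_eq_prod: "L_lcm k = (\<Prod>p\<in>{p. prime p \<and> p \<le> k}. p ^ e_val p k)"
proof (rule multiplicity_eq_nat)
  have fin: "finite {p. prime p \<and> p \<le> k}" by simp
  have "L_lcm k \<noteq> 0" unfolding L_lcm_def by (subst Lcm_0_iff) auto
  then show "L_lcm k > 0" by blast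
  show "(\<Prod>p\<in>{p. prime p \<and> p \<le> k}. p ^ e_val p k) > 0" by (intro prod_pos) (auto simp: prime_gt_0_nat)
  fix p :: nat assume p: "prime p"
  have "multiplicity p (L_lcm k) = (if p \<le> k then e_val p k else 0)"
  proof (cases "p \<le> k")
    case True
    then have k: "k \<ge> 1" using prime_gt_0_nat[OF p] by simp
    have "p ^ e_val p k dvd L_lcm k" by (rule prime_power_e_dvd_L[OF p k])
    moreover have "\<not> p ^ Suc (e_val p k) dvd L_lcm k"
      using prime_power_dvd_L_lcm_iff[OF p, of "Suc (e_val p k)" k]
        power_le_iff_le_e_val[OF p k, of "Suc (e_val p k)"] by simp
    ultimately show ?thesis using True by (simp add: multiplicity_eqI)
  next
    case False
    then show ?thesis using p by (simp add: not_dvd_imp_multiplicity_0 prime_dvd_L_lcm_iff)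
  qed
  also have "\<dots> = multiplicity p (\<Prod>p\<in>{p. prime p \<and> p \<le> k}. p ^ e_val p k)"
    using p fin by (subst multiplicity_prod_prime_powers) auto
  finally show "multiplicity p (L_lcm k) = multiplicity p (\<Prod>p\<in>{p. prime p \<and> p \<le> k}. p ^ e_val p k)" .
qed

text \<open>The index set has at most one element; written as a product, \<open>delta\<close> needs no case distinction
  when it is combined with the other factors of \<open>L_lcm k\<close>.\<close>

lemma delta_eq_prod: "delta k a = (\<Prod>p\<in>{p. is_delta_prime k a p}. p ^ e_val p k)"
proof (cases "\<exists>p. is_delta_prime k a p")
  case True
  then obtain p where p: "is_delta_prime k a p" by blast
  then have "{p. is_delta_prime k a p} = {p}" "(THE p. is_delta_prime k a p) = p"
    by (blast intro: delta_prime_unique)+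
  then show ?thesis using True by (simp add: delta_def Let_def)
qed (simp add: delta_def)

lemma is_delta_prime_iff:
  "is_delta_prime k a p \<longleftrightarrow> prime p \<and> p \<le> k \<and> \<not> p dvd a \<and> p ^ e_val p k dvd k + 1"
  by (auto simp: is_delta_prime_def prime_power_dvd_iff_le_multiplicity)

text \<open>The primes up to \<open>k\<close> split into those dividing \<open>a\<close>, the possible exceptional prime of
  \<open>delta\<close>, and the essential ones.\<close>

lemma Q_per_eq_prod: "Q_per k a = (\<Prod>p\<in>essential_primes k a. p ^ e_val p k)"
proof -
  let ?D = "{p. is_delta_prime k a p}"
  let ?A = "{q. prime q \<and> q dvd gcd a (L_lcm k)}"
  let ?w = "\<lambda>p. p ^ e_val p k"
  have A: "?A = {q. prime q \<and> q \<le> k \<and> q dvd a}" by (auto simp: prime_dvd_L_lcm_iff)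
  have finA: "finite ?A" unfolding A by simp
  have finD: "finite ?D" by (rule finite_subset[of _ "{..k}"]) (auto simp: is_delta_prime_def)
  have "{p. prime p \<and> p \<le> k} = (?D \<union> ?A) \<union> essential_primes k a"
    unfolding A by (auto simp: is_delta_prime_iff essential_primes_def)
  then have "L_lcm k = prod ?w (?D \<union> ?A \<union> essential_primes k a)"
    by (simp add: L_lcm_eq_prod)
  also have "\<dots> = prod ?w (?D \<union> ?A) * prod ?w (essential_primes k a)"
    using finA finD finite_essential_primes
    by (intro prod.union_disjoint) (auto simp: is_delta_prime_iff essential_primes_def)
  also have "prod ?w (?D \<union> ?A) = delta k a * prod ?w ?A"
    using finA finD unfolding delta_eq_prod
    by (intro prod.union_disjoint) (auto simp: is_delta_prime_iff)
  finally have L: "L_lcm k = (delta k a * prod ?w ?A) * prod ?w (essential_primes k a)" .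
  have "delta k a > 0" unfolding delta_eq_prod
    by (intro prod_pos) (auto simp: is_delta_prime_def prime_gt_0_nat)
  moreover have "prod ?w ?A > 0" by (intro prod_pos) (auto simp: prime_gt_0_nat)
  ultimately have "delta k a * prod ?w ?A > 0" by (rule mult_pos_pos)
  moreover have "x div d = y" if "x = d * y" "d > 0" for x d y :: nat using that by simp
  ultimately show ?thesis unfolding Q_per_def using L by blast
qed

lemma Q_per_pos: "Q_per k a > 0"
  unfolding Q_per_eq_prod by (intro prod_pos) (auto simp: essential_primes_def prime_gt_0_nat)

lemma prod_prime_powers_dvd_iff:
  fixes T :: nat
  assumes "finite S" "\<And>p. p \<in> S \<Longrightarrow> prime p"
  shows "(\<Prod>p\<in>S. p ^ f p) dvd T \<longleftrightarrow> (\<forall>p\<in>S. p ^ f p dvd T)"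
  using assms
proof (induction S rule: finite_induct)
  case (insert x S)
  let ?P = "\<Prod>p\<in>S. p ^ f p"
  have cop: "coprime (x ^ f x) ?P"
    using insert by (intro prod_coprime_right) (auto intro!: primes_coprime)
  have "x ^ f x * ?P dvd T \<longleftrightarrow> x ^ f x dvd T \<and> ?P dvd T"
  proof
    assume "x ^ f x * ?P dvd T"
    then show "x ^ f x dvd T \<and> ?P dvd T" by (intro conjI; elim dvd_mult_left dvd_mult_right)
  next
    assume "x ^ f x dvd T \<and> ?P dvd T"
    then show "x ^ f x * ?P dvd T" using cop by (intro divides_mult) simp_all
  qed
  moreover have "?P dvd T \<longleftrightarrow> (\<forall>p\<in>S. p ^ f p dvd T)" using insert by simp
  ultimately show ?case using insert.hyps by simp
qed simp

text \<open>Primes above \<open>k\<close> impose no condition on \<open>T\<close>, because there \<open>p ^ e_val p k = 1\<close>.\<close>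

lemma is_period_g_fun_iff_Q_per_dvd:
  assumes "a \<ge> 1" "coprime a b"
  shows "is_period (g_fun k a b) T \<longleftrightarrow> T > 0 \<and> Q_per k a dvd T"
proof -
  have small: "p \<le> k" if "prime p" "\<not> p ^ e_val p k dvd k + 1" for p
  proof (rule ccontr)
    assume "\<not> p \<le> k"
    then have "e_val p k = 0" using that(1) by (intro e_val_eq_0) auto
    then show False using that(2) by simp
  qed
  have "Q_per k a dvd T \<longleftrightarrow> (\<forall>p\<in>essential_primes k a. p ^ e_val p k dvd T)"
    unfolding Q_per_eq_prod using finite_essential_primes
    by (intro prod_prime_powers_dvd_iff) (auto simp: essential_primes_def)
  moreover have "is_period (g_fun k a b) T \<longleftrightarrow>
      T > 0 \<and> (\<forall>p\<in>essential_primes k a. p ^ e_val p k dvd T)" (is "?per \<longleftrightarrow> ?dvd")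
  proof
    assume ?per
    then show ?dvd
      using prime_power_dvd_period_g_fun[OF assms] by (auto simp: essential_primes_def is_period_def)
  next
    assume ?dvd
    then show ?per using small by (intro is_period_g_funI[OF assms]) (auto simp: essential_primes_def)
  qed
  ultimately show ?thesis by blast
qed

section \<open>Reduction to the coprime case\<close>

text \<open>The product of \<open>k + 1\<close> terms gains the factor \<open>d ^ (k + 1)\<close>, and the lcm gains \<open>d\<close>.\<close>

lemma g_fun_scale:
  assumes "d > 0"
  shows "g_fun k (d * a) (d * b) n = d ^ k * g_fun k a b n"
proof -
  let ?x = "\<lambda>i. b + (n + i) * a"
  let ?L = "Lcm (?x ` {0..k})"
  have x: "d * b + (n + i) * (d * a) = d * ?x i" for i by (simp add: algebra_simps)
  have "Lcm ((\<lambda>i. d * ?x i) ` {0..k}) = Lcm ((*) d ` (?x ` {0..k}))" by (simp add: image_image)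
  also have "\<dots> = d * ?L" by (subst Lcm_mult) auto
  finally have "g_fun k (d * a) (d * b) n = (d ^ Suc k * (\<Prod>i=0..k. ?x i)) div (d * ?L)"
    unfolding g_fun_def x by (simp add: prod.distrib)
  also have "\<dots> = (d ^ k * (\<Prod>i=0..k. ?x i)) div ?L" using assms by (simp add: mult.assoc)
  also have "\<dots> = d ^ k * g_fun k a b n" unfolding g_fun_def using g_exact by (rule div_mult_swap[symmetric])
  finally show ?thesis .
qed

lemma smallest_period_eqI:
  assumes "\<And>T. is_period f T \<longleftrightarrow> T > 0 \<and> Q dvd T" "Q > 0"
  shows "smallest_period f = Q"
  unfolding smallest_period_def
proof (rule Least_equality)
  show "is_period f Q" using assms(2) unfolding assms(1) by simp
  show "Q \<le> T" if "is_period f T" for T using that assms(1) dvd_imp_le by blast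
qed

lemma is_period_g_fun_iff_reduced:
  assumes "a \<ge> 1"
  shows "is_period (g_fun k a b) T \<longleftrightarrow> T > 0 \<and> Q_per k (a div gcd a b) dvd T"
proof -
  define d where "d = gcd a b"
  have d: "d > 0" using assms by (simp add: d_def)
  have "coprime (a div d) (b div d)" using assms unfolding d_def by (intro div_gcd_coprime) auto
  moreover have "a div d \<ge> 1" using assms d unfolding d_def by (simp add: Suc_le_eq div_greater_zero_iff gcd_le1_nat)
  moreover have "g_fun k a b n = d ^ k * g_fun k (a div d) (b div d) n" for n
    using g_fun_scale[OF d, of k "a div d" "b div d" n] by (simp add: d_def)
  then have "is_period (g_fun k a b) T \<longleftrightarrow> is_period (g_fun k (a div d) (b div d)) T"
    using d by (simp add: is_period_def)
  ultimately show ?thesis using is_period_g_fun_iff_Q_per_dvd d_def by simp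
qed

theorem theorem1p2:
  fixes k a b :: nat
  assumes "a \<ge> 1"
  shows "periodic (g_fun k a b)
    \<and> (gcd a b = 1 \<longrightarrow> smallest_period (g_fun k a b) = Q_per k a)
    \<and> (gcd a b > 1 \<longrightarrow> smallest_period (g_fun k a b) = Q_per k (a div gcd a b))"
proof -
  let ?Q = "Q_per k (a div gcd a b)"
  have "is_period (g_fun k a b) ?Q"
    by (simp add: is_period_g_fun_iff_reduced[OF assms] Q_per_pos)
  then have "periodic (g_fun k a b)" unfolding periodic_def by (rule exI)
  moreover have "smallest_period (g_fun k a b) = ?Q"
    by (rule smallest_period_eqI[OF is_period_g_fun_iff_reduced[OF assms] Q_per_pos])
  ultimately show ?thesis by simp
qed

end
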